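(* If $\Omega$ is unbounded and $\Phi$ is a non-automorphic analytic self-map of $\Omega$ with a fixed point in $\Omega$ and such that $C_{\Phi}$ is bounded on $H^{2}(\Omega)$, then $C_{\Phi}$ is not complex symmetric.
   Context: $\mathbb{U}$ is the open unit disc, $\Omega$ is an open simply connected proper subset of $\mathbb{C}$, and $\tau:\mathbb{U}\to\Omega$ is a Riemann map, i.e. a biholomorphic map of $\mathbb{U}$ onto $\Omega$ (here arbitrary, not assumed linear fractional). The Hardy-Smirnov space $H^{2}(\Omega)$ is the set of analytic $f:\Omega\to\mathbb{C}$ with $\|f\|^{2}=\sup_{0<r<1}\frac{1}{2\pi}\int_{\Gamma_r}|f(w)|^{2}|dw|<\infty$, where $\Gamma_r=\tau(\{|z|=r\})$. Fix an analytic branch of $(\tau')^{1/2}$ on $\mathbb{U}$. The map $Vf=(f\circ\tau)(\tau')^{1/2}$ is an isometric isomorphism from $H^2(\Omega)$ onto the classical Hardy space $H^2(\mathbb{U})$, and $H^{2}(\Omega)$ is a Hilbert space with inner product $\langle f,g\rangle=\langle Vf,Vg\rangle_{2}$, where $\langle\cdot,\cdot\rangle_2$ is the inner product of $H^2(\mathbb{U})$. For an analytic self-map $\Phi$ of $\Omega$, $C_{\Phi}f=f\circ\Phi$. "Non-automorphic" means that $\Phi$ is not a biholomorphic map of $\Omega$ onto itself. A conjugation $C$ on a complex Hilbert space $\mathcal H$ is a conjugate-linear map with $\langle Cf,Cg\rangle=\langle g,f\rangle$ for all $f,g$ and $C^2=Id$. A bounded operator $T$ on $\mathcal H$ is complex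 symmetric if there is a conjugation $C$ on $\mathcal H$ with $CT=T^*C$. *)

theory Defs
  imports "HOL-Complex_Analysis.Complex_Analysis"
begin

definition biholomorphic_map :: "(complex \<Rightarrow> complex) \<Rightarrow> complex set \<Rightarrow> complex set \<Rightarrow> bool" where
  "biholomorphic_map f S T \<longleftrightarrow>
     f holomorphic_on S \<and> bij_betw f S T \<and> inv_into S f holomorphic_on T"

text \<open>The integral of \<open>h\<close> with respect to arc length \<open>|dw|\<close> along the path \<open>\<gamma>\<close>.\<close>

definition arclength_integral :: "(real \<Rightarrow> complex) \<Rightarrow> (complex \<Rightarrow> real) \<Rightarrow> real" where
  "arclength_integral \<gamma> h = integral {0..1} (\<lambda>t. h (\<gamma> t) * norm (vector_derivative \<gamma> (at t)))"

definition hs_mean :: "(complex \<Rightarrow> complex) \<Rightarrow> (complex \<Rightarrow> complex) \<Rightarrow> real \<Rightarrow> real" where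
  "hs_mean \<tau> f r = 1 / (2 * pi) * arclength_integral (\<tau> \<circ> circlepath 0 r) (\<lambda>w. (cmod (f w))\<^sup>2)"

text \<open>A function on \<open>\<Omega>\<close> is represented by its extension by \<open>0\<close> to the whole plane, so that
  equality of elements of the space is equality of functions.\<close>

definition hardy_smirnov :: "complex set \<Rightarrow> (complex \<Rightarrow> complex) \<Rightarrow> (complex \<Rightarrow> complex) set" where
  "hardy_smirnov \<Omega> \<tau> = {f. f holomorphic_on \<Omega> \<and> (\<forall>w. w \<notin> \<Omega> \<longrightarrow> f w = 0) \<and>
                            bdd_above (hs_mean \<tau> f ` {0<..<1})}"

definition hs_norm :: "(complex \<Rightarrow> complex) \<Rightarrow> (complex \<Rightarrow> complex) \<Rightarrow> real" where
  "hs_norm \<tau> f = sqrt (SUP r\<in>{0<..<1}. hs_mean \<tau> f r)"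

definition taylor_coeff :: "(complex \<Rightarrow> complex) \<Rightarrow> nat \<Rightarrow> complex" where
  "taylor_coeff f n = (deriv ^^ n) f 0 / fact n"

text \<open>The inner product of the classical Hardy space of the unit disc; the series converges
  absolutely for \<open>f\<close> and \<open>g\<close> in that space.\<close>

definition hardy_inner :: "(complex \<Rightarrow> complex) \<Rightarrow> (complex \<Rightarrow> complex) \<Rightarrow> complex" where
  "hardy_inner f g = (\<Sum>n. taylor_coeff f n * cnj (taylor_coeff g n))"

text \<open>Here \<open>s\<close> stands for the chosen analytic branch of the square root of \<open>\<tau>'\<close>.\<close>

definition hs_V ::
  "(complex \<Rightarrow> complex) \<Rightarrow> (complex \<Rightarrow> complex) \<Rightarrow> (complex \<Rightarrow> complex) \<Rightarrow> complex \<Rightarrow> complex" where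
  "hs_V \<tau> s f = (\<lambda>z. f (\<tau> z) * s z)"

definition hs_inner ::
  "(complex \<Rightarrow> complex) \<Rightarrow> (complex \<Rightarrow> complex) \<Rightarrow> (complex \<Rightarrow> complex) \<Rightarrow> (complex \<Rightarrow> complex) \<Rightarrow> complex" where
  "hs_inner \<tau> s f g = hardy_inner (hs_V \<tau> s f) (hs_V \<tau> s g)"

definition composition_op ::
  "complex set \<Rightarrow> (complex \<Rightarrow> complex) \<Rightarrow> (complex \<Rightarrow> complex) \<Rightarrow> complex \<Rightarrow> complex" where
  "composition_op \<Omega> \<Phi> f = (\<lambda>w. if w \<in> \<Omega> then f (\<Phi> w) else 0)"

text \<open>Operators on a space \<open>H\<close> of complex-valued functions (with pointwise vector space
  operations) carrying a norm \<open>nrm\<close> or an inner product \<open>ip\<close>, conjugate-linear in its second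
  argument.\<close>

definition bounded_operator_on ::
  "('a \<Rightarrow> complex) set \<Rightarrow> (('a \<Rightarrow> complex) \<Rightarrow> real) \<Rightarrow>
   (('a \<Rightarrow> complex) \<Rightarrow> ('a \<Rightarrow> complex)) \<Rightarrow> bool" where
  "bounded_operator_on H nrm T \<longleftrightarrow>
     (\<forall>f\<in>H. T f \<in> H) \<and>
     (\<forall>f\<in>H. \<forall>g\<in>H. \<forall>a b. T (\<lambda>x. a * f x + b * g x) = (\<lambda>x. a * T f x + b * T g x)) \<and>
     (\<exists>K. \<forall>f\<in>H. nrm (T f) \<le> K * nrm f)"

definition conjugation_on ::
  "('a \<Rightarrow> complex) set \<Rightarrow> (('a \<Rightarrow> complex) \<Rightarrow> ('a \<Rightarrow> complex) \<Rightarrow> complex) \<Rightarrow>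
   (('a \<Rightarrow> complex) \<Rightarrow> ('a \<Rightarrow> complex)) \<Rightarrow> bool" where
  "conjugation_on H ip C \<longleftrightarrow>
     (\<forall>f\<in>H. C f \<in> H) \<and>
     (\<forall>f\<in>H. \<forall>g\<in>H. \<forall>a b. C (\<lambda>x. a * f x + b * g x) = (\<lambda>x. cnj a * C f x + cnj b * C g x)) \<and>
     (\<forall>f\<in>H. \<forall>g\<in>H. ip (C f) (C g) = ip g f) \<and>
     (\<forall>f\<in>H. C (C f) = f)"

definition is_adjoint_on ::
  "('a \<Rightarrow> complex) set \<Rightarrow> (('a \<Rightarrow> complex) \<Rightarrow> ('a \<Rightarrow> complex) \<Rightarrow> complex) \<Rightarrow>
   (('a \<Rightarrow> complex) \<Rightarrow> ('a \<Rightarrow> complex)) \<Rightarrow> (('a \<Rightarrow> complex) \<Rightarrow> ('a \<Rightarrow> complex)) \<Rightarrow> bool" where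
  "is_adjoint_on H ip T S \<longleftrightarrow>
     (\<forall>f\<in>H. S f \<in> H) \<and> (\<forall>f\<in>H. \<forall>g\<in>H. ip (T f) g = ip f (S g))"

text \<open>To be used for bounded operators \<open>T\<close> on a Hilbert space \<open>H\<close>: there the adjoint exists and
  is unique on \<open>H\<close>, so the quantifier over \<open>S\<close> only names it.\<close>

definition complex_symmetric_on ::
  "('a \<Rightarrow> complex) set \<Rightarrow> (('a \<Rightarrow> complex) \<Rightarrow> ('a \<Rightarrow> complex) \<Rightarrow> complex) \<Rightarrow>
   (('a \<Rightarrow> complex) \<Rightarrow> ('a \<Rightarrow> complex)) \<Rightarrow> bool" where
  "complex_symmetric_on H ip T \<longleftrightarrow>
     (\<exists>C S. conjugation_on H ip C \<and> is_adjoint_on H ip T S \<and> (\<forall>f\<in>H. C (T f) = S (C f)))"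

end

theory Submission
  imports Defs
begin

text \<open>Let \<open>k\<close> be the reproducing kernel of \<open>H\<^sup>2(\<Omega>)\<close> at the fixed point of \<open>\<Phi>\<close>. The adjoint
  of \<open>C\<^sub>\<Phi>\<close> fixes \<open>k\<close>, so if \<open>C\<close> is a conjugation with \<open>C C\<^sub>\<Phi> = C\<^sub>\<Phi>\<^sup>* C\<close>, then \<open>f = C k\<close> is a
  nonzero function with \<open>f \<circ> \<Phi> = f\<close>. Moving the fixed point to \<open>0\<close>, the Schwarz lemma and the
  maximum principle make \<open>f\<close> constant. Hence the square root \<open>s = \<Sum> b\<^sub>n z\<^sup>n\<close> of \<open>\<tau>'\<close> satisfies
  \<open>\<Sum> |b\<^sub>n|\<^sup>2 < \<infinity>\<close>, and the absolute values of the Taylor coefficients of \<open>\<tau> - \<tau> 0\<close> add up to at most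
  \<open>\<Sum>\<^sub>j\<^sub>,\<^sub>k |b\<^sub>j| |b\<^sub>k| / (j + k + 1)\<close>, which is finite by Hilbert's inequality. So \<open>\<Omega>\<close> is bounded.\<close>

section \<open>Hilbert's inequality by the Schur test\<close>

text \<open>Discrete form of the integral of sqrt c / (sqrt t * (c + t)) over t > 0, which equals pi
  for every c. The arctangent primitive is replaced by the algebraic \<open>h\<close>, whose values
  lie in [0, 1], and the sum telescopes. The constant 8 collects a factor 2 lost in bounding y - x
  from below and a factor 4 lost in the denominator.\<close>

lemma schur_weight_bound:
  fixes c :: real
  assumes "c \<ge> 1"
  shows "(\<Sum>k<N. sqrt c / (sqrt (real k + 1) * (c + real k))) \<le> 8"
proof -
  define h where "h k = sqrt (real k) / (sqrt (real k) + sqrt c)" for k :: nat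
  have step: "sqrt c / (sqrt (real k + 1) * (c + real k)) \<le> 8 * (h (Suc k) - h k)" for k
  proof -
    define x y d where "x = sqrt (real k)" "y = sqrt (real k + 1)" "d = sqrt c"
    have x: "0 \<le> x" "x\<^sup>2 = real k" and y: "0 < y" "y\<^sup>2 = x\<^sup>2 + 1" and d: "1 \<le> d" "d\<^sup>2 = c"
      using assms by (auto simp: x_y_d_def)
    have "x \<le> y" by (simp add: x_y_d_def)
    have diff: "y - x \<ge> 1 / (2 * y)"
    proof -
      have "(y - x) * (y + x) = 1" using y by (simp add: algebra_simps power2_eq_square)
      moreover have "(y - x) * (y + x) \<le> (y - x) * (2 * y)"
        using \<open>x \<le> y\<close> by (intro mult_left_mono) auto
      ultimately show ?thesis using y by (simp add: divide_le_eq)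
    qed
    have den: "(y + d) * (x + d) \<le> 4 * (c + real k)"
    proof -
      have "(y + d) * (x + d) \<le> (y + d)\<^sup>2"
        unfolding power2_eq_square using \<open>x \<le> y\<close> y d by (intro mult_left_mono) auto
      also have "\<dots> \<le> 2 * (y\<^sup>2 + d\<^sup>2)"
        using sum_squares_bound[of y d] by (simp add: power2_sum)
      \<comment> \<open>Here c >= 1 absorbs the 1 in y^2 = k + 1.\<close>
      also have "\<dots> \<le> 4 * (c + real k)" using y d x assms by simp
      finally show ?thesis .
    qed
    have pos: "0 < (y + d) * (x + d)" "0 < c + real k" using x y d assms by auto
    have "h (Suc k) - h k = y / (y + d) - x / (x + d)"
      by (simp add: h_def x_y_d_def add.commute)
    also have "\<dots> = d * (y - x) / ((y + d) * (x + d))"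
      using x y d by (simp add: field_simps)
    also have "\<dots> \<ge> d * (1 / (2 * y)) / (4 * (c + real k))"
      using diff den pos d y by (intro frac_le mult_left_mono) (auto intro!: mult_nonneg_nonneg simp: \<open>x \<le> y\<close>)
    finally have "8 * (d * (1 / (2 * y)) / (4 * (c + real k))) \<le> 8 * (h (Suc k) - h k)"
      by (rule mult_left_mono) simp
    moreover have "8 * (d * (1 / (2 * y)) / (4 * e)) = d / (y * e)" for e
      by simp
    ultimately show ?thesis by (simp only: x_y_d_def)
  qed
  have "(\<Sum>k<N. sqrt c / (sqrt (real k + 1) * (c + real k))) \<le> (\<Sum>k<N. 8 * (h (Suc k) - h k))"
    by (intro sum_mono step)
  also have "\<dots> = 8 * (h N - h 0)"
    by (simp only: sum_distrib_left[symmetric] sum_lessThan_telescope)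
  also have "\<dots> \<le> 8"
    using assms by (simp add: h_def divide_le_eq add_nonneg_pos)
  finally show ?thesis .
qed

text \<open>Schur test with the weights \<open>sqrt (n + 1)\<close>.\<close>

lemma hilbert_inequality:
  fixes a :: "nat \<Rightarrow> real"
  assumes "\<And>n. a n \<ge> 0"
  shows "(\<Sum>j<N. \<Sum>k<N. a j * a k / real (j + k + 1)) \<le> 8 * (\<Sum>j<N. (a j)\<^sup>2)"
proof -
  \<comment> \<open>The Hilbert kernel times the ratio of the weights at j and k. Its row sums are
    those of \<open>schur_weight_bound\<close> with c = j + 1.\<close>
  define w where "w j k = sqrt (real j + 1) / (sqrt (real k + 1) * (real j + 1 + real k))" for j k :: nat
  have pt: "a j * a k / real (j + k + 1) \<le> ((a j)\<^sup>2 * w j k + (a k)\<^sup>2 * w k j) / 2" for j k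
  proof -
    \<comment> \<open>Fourth roots, so that the squares produced by 2xy <= x^2 + y^2 carry exactly
      the weight ratios in \<open>w j k\<close> and \<open>w k j\<close>.\<close>
    define p q where "p = sqrt (sqrt (real j + 1))" "q = sqrt (sqrt (real k + 1))"
    have pq: "p > 0" "q > 0" "p\<^sup>2 = sqrt (real j + 1)" "q\<^sup>2 = sqrt (real k + 1)"
      by (auto simp: p_q_def)
    have "2 * (a j * a k) = 2 * (a j * p / q) * (a k * q / p)"
      using pq by simp
    also have "\<dots> \<le> (a j * p / q)\<^sup>2 + (a k * q / p)\<^sup>2"
      by (rule sum_squares_bound)
    finally have "2 * (a j * a k) \<le> (a j)\<^sup>2 * (p\<^sup>2 / q\<^sup>2) + (a k)\<^sup>2 * (q\<^sup>2 / p\<^sup>2)"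
      by (simp add: power_divide power_mult_distrib)
    hence "2 * (a j * a k) / real (j + k + 1)
        \<le> ((a j)\<^sup>2 * (p\<^sup>2 / q\<^sup>2) + (a k)\<^sup>2 * (q\<^sup>2 / p\<^sup>2)) / real (j + k + 1)"
      by (intro divide_right_mono) auto
    also have "\<dots> = (a j)\<^sup>2 * w j k + (a k)\<^sup>2 * w k j"
      unfolding w_def pq by (simp add: add_divide_distrib algebra_simps)
    finally show ?thesis by (simp add: mult_ac)
  qed
  have "(\<Sum>j<N. \<Sum>k<N. a j * a k / real (j + k + 1))
      \<le> (\<Sum>j<N. \<Sum>k<N. ((a j)\<^sup>2 * w j k + (a k)\<^sup>2 * w k j) / 2)"
    by (intro sum_mono pt)
  also have "\<dots> = ((\<Sum>j<N. \<Sum>k<N. (a j)\<^sup>2 * w j k) + (\<Sum>j<N. \<Sum>k<N. (a k)\<^sup>2 * w k j)) / 2"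
    by (simp add: sum.distrib sum_divide_distrib[symmetric])
  also have "(\<Sum>j<N. \<Sum>k<N. (a k)\<^sup>2 * w k j) = (\<Sum>j<N. \<Sum>k<N. (a j)\<^sup>2 * w j k)"
    by (rule sum.swap)
  also have "((\<Sum>j<N. \<Sum>k<N. (a j)\<^sup>2 * w j k) + (\<Sum>j<N. \<Sum>k<N. (a j)\<^sup>2 * w j k)) / 2
      = (\<Sum>j<N. (a j)\<^sup>2 * (\<Sum>k<N. w j k))"
    by (simp add: sum_distrib_left[symmetric])
  also have "\<dots> \<le> (\<Sum>j<N. (a j)\<^sup>2 * 8)"
    unfolding w_def by (intro sum_mono mult_left_mono schur_weight_bound) auto
  finally show ?thesis by (simp add: sum_distrib_left mult.commute)
qed

section \<open>Boundedness from the coefficients of a square root of the derivative\<close>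

text \<open>Since the derivative of \<open>\<tau>\<close> is s * s, its coefficients are Cauchy
  products of those of \<open>s\<close>. Integration divides by n + 1 = i + j + 1 on the
  antidiagonal i + j = n, which is the Hilbert kernel. The Taylor series of \<open>\<tau>\<close> is
  therefore dominated by a convergent series independent of z.\<close>

lemma bounded_if_deriv_square_coeffs:
  fixes s \<tau> :: "complex \<Rightarrow> complex"
  assumes s: "s holomorphic_on ball 0 1" and \<tau>: "\<tau> holomorphic_on ball 0 1"
    and sq: "\<And>z. z \<in> ball 0 1 \<Longrightarrow> (s z)\<^sup>2 = deriv \<tau> z"
    and M: "\<And>N. (\<Sum>n<N. (cmod (taylor_coeff s n))\<^sup>2) \<le> M"
  shows "bounded (\<tau> ` ball 0 1)"
proof -
  define b where "b n = cmod (taylor_coeff s n)" for n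
  have coeff: "taylor_coeff \<tau> (Suc n) = (\<Sum>i\<le>n. taylor_coeff s i * taylor_coeff s (n - i)) / of_nat (n + 1)" for n
  proof -
    have "(deriv ^^ Suc n) \<tau> 0 = (deriv ^^ n) (deriv \<tau>) 0"
      by (simp add: funpow_swap1)
    also have "\<dots> = (deriv ^^ n) (\<lambda>z. s z * s z) 0"
      by (rule higher_deriv_transform_within_open[where S = "ball 0 1"])
         (use s \<tau> sq in \<open>auto intro!: holomorphic_intros simp: power2_eq_square\<close>)
    also have "\<dots> = (\<Sum>i=0..n. of_nat (n choose i) * (deriv ^^ i) s 0 * (deriv ^^ (n - i)) s 0)"
      by (rule higher_deriv_mult[where S = "ball 0 1"]) (use s in auto)
    also have "\<dots> = (\<Sum>i\<le>n. fact n * (taylor_coeff s i * taylor_coeff s (n - i)))"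
      by (intro sum.cong) (auto simp: taylor_coeff_def binomial_fact)
    finally have "(deriv ^^ Suc n) \<tau> 0 = fact n * (\<Sum>i\<le>n. taylor_coeff s i * taylor_coeff s (n - i))"
      by (simp only: sum_distrib_left)
    thus ?thesis
      unfolding taylor_coeff_def[of \<tau>] by simp
  qed
  \<comment> \<open>The denominator n + 1 is written in terms of i and n - i so that the sum over
    the triangle can be reindexed by pairs (i, j).\<close>
  have bound: "cmod (taylor_coeff \<tau> (Suc n)) \<le> (\<Sum>i\<le>n. b i * b (n - i) / real (i + (n - i) + 1))" for n
  proof -
    have "cmod (taylor_coeff \<tau> (Suc n)) \<le> (\<Sum>i\<le>n. b i * b (n - i)) / real (n + 1)"
      unfolding coeff norm_divide b_def norm_mult[symmetric]
      by (simp only: norm_of_nat) (intro divide_right_mono norm_sum, simp)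
    thus ?thesis by (simp add: sum_divide_distrib)
  qed
  have part: "(\<Sum>n<N. cmod (taylor_coeff \<tau> (Suc n))) \<le> 8 * M" for N
  proof -
    have "(\<Sum>n<N. cmod (taylor_coeff \<tau> (Suc n)))
        \<le> (\<Sum>n<N. \<Sum>i\<le>n. b i * b (n - i) / real (i + (n - i) + 1))"
      by (intro sum_mono bound)
    also have "\<dots> = (\<Sum>(i,j)\<in>{(i,j). i + j < N}. b i * b j / real (i + j + 1))"
      by (rule sum.triangle_reindex[symmetric])
    also have "\<dots> \<le> (\<Sum>(i,j)\<in>{..<N} \<times> {..<N}. b i * b j / real (i + j + 1))"
      by (intro sum_mono2) (auto simp: b_def)
    also have "\<dots> = (\<Sum>i<N. \<Sum>j<N. b i * b j / real (i + j + 1))"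
      by (simp add: sum.cartesian_product)
    also have "\<dots> \<le> 8 * (\<Sum>j<N. (b j)\<^sup>2)"
      by (rule hilbert_inequality) (simp add: b_def)
    also have "\<dots> \<le> 8 * M" using M[of N] by (simp add: b_def)
    finally show ?thesis .
  qed
  have "cmod (\<tau> z) \<le> cmod (\<tau> 0) + 8 * M" if z: "z \<in> ball 0 1" for z
  proof -
    have sums: "(\<lambda>n. taylor_coeff \<tau> n * z ^ n) sums \<tau> z"
      using holomorphic_power_series[OF \<tau> z] by (simp add: taylor_coeff_def)
    have "cmod (\<Sum>n<N. taylor_coeff \<tau> n * z ^ n) \<le> cmod (\<tau> 0) + 8 * M" for N
    proof (cases N)
      case 0
      \<comment> \<open>The empty sum in \<open>part\<close> yields 0 <= 8 * M.\<close>
      then show ?thesis using part[of 0] by (simp add: add_nonneg_nonneg)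
    next
      case (Suc m)
      have "cmod (\<Sum>n<N. taylor_coeff \<tau> n * z ^ n)
          \<le> (\<Sum>n<Suc m. cmod (taylor_coeff \<tau> n))"
        unfolding Suc
        by (rule order.trans[OF norm_sum], rule sum_mono)
           (use z in \<open>auto simp: norm_mult norm_power intro!: mult_left_le power_le_one\<close>)
      also have "\<dots> = cmod (\<tau> 0) + (\<Sum>n<m. cmod (taylor_coeff \<tau> (Suc n)))"
        by (subst sum.lessThan_Suc_shift) (simp add: taylor_coeff_def)
      also have "\<dots> \<le> cmod (\<tau> 0) + 8 * M" using part by simp
      finally show ?thesis .
    qed
    thus ?thesis
      using sums unfolding sums_def by (intro Lim_bounded[OF tendsto_norm]) auto
  qed
  thus ?thesis by (intro boundedI) auto
qed

section \<open>Circle means and Taylor coefficients\<close>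

text \<open>The derivative of the circle path is 2 pi i times its point, so this is Cauchy's theorem
  for h divided by 2 pi i.\<close>

lemma circle_integral_holomorphic:
  assumes "h holomorphic_on ball 0 1" "0 < r" "r < 1"
  shows "((\<lambda>t. circlepath 0 r t * h (circlepath 0 r t)) has_integral 0) {0..1}"
proof -
  have "(h has_contour_integral 0) (circlepath 0 r)"
    using assms by (intro Cauchy_theorem_convex_simple[where S = "ball 0 1"]) auto
  hence "((\<lambda>t. h (circlepath 0 r t) * vector_derivative (circlepath 0 r) (at t)) has_integral 0) {0..1}"
    by (simp add: has_contour_integral)
  hence "((\<lambda>t. (1 / (2 * of_real pi * \<i>)) *
      (h (circlepath 0 r t) * vector_derivative (circlepath 0 r) (at t))) has_integral
      (1 / (2 * of_real pi * \<i>)) * 0) {0..1}"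
    by (rule has_integral_mult_right)
  thus ?thesis
    unfolding vector_derivative_circlepath by (simp add: circlepath mult_ac)
qed

lemma circle_continuous:
  assumes "f holomorphic_on ball 0 1" "0 < r" "r < 1"
  shows "continuous_on {0..1} (\<lambda>t. f (circlepath 0 r t))"
proof -
  have "continuous_on (ball 0 1) f" using assms by (intro holomorphic_on_imp_continuous_on)
  thus ?thesis
    by (rule continuous_on_compose2)
       (use assms in \<open>auto simp: circlepath norm_mult intro!: continuous_intros\<close>)
qed

lemma norm_circlepath0: "r > 0 \<Longrightarrow> cmod (circlepath 0 r t) = r"
  by (simp add: circlepath norm_mult)

text \<open>Writing \<open>f z = b 0 + z h z\<close>, the cross term integrates to \<open>0\<close> by Cauchy's theorem, which
  reduces the claim to the shifted sequence and \<open>h\<close>.\<close>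

lemma bessel_inequality_circle:
  assumes "\<And>z. z \<in> ball 0 1 \<Longrightarrow> (\<lambda>n. b n * z ^ n) sums f z" and r: "0 < r" "r < 1"
  shows "(\<Sum>n<N. (cmod (b n))\<^sup>2 * (r\<^sup>2) ^ n) \<le> integral {0..1} (\<lambda>t. (cmod (f (circlepath 0 r t)))\<^sup>2)"
  using assms(1)
proof (induction N arbitrary: b f)
  case 0
  have "f holomorphic_on ball 0 1"
    by (rule power_series_holomorphic[where a = b]) (use 0 in simp)
  thus ?case
    using r by (auto intro!: integral_nonneg integrable_continuous_interval continuous_intros
      circle_continuous)
next
  case (Suc N)
  note f = Suc.prems
  define h where "h z = (\<Sum>n. b (Suc n) * z ^ n)" for z
  have h: "(\<lambda>n. b (Suc n) * z ^ n) sums h z" if "z \<in> ball 0 1" for z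
  \<comment> \<open>The shifted series is obtained by dividing by z; at z = 0 only its constant term
    survives.\<close>
  proof (cases "z = 0")
    case True
    have "summable (\<lambda>n. b (Suc n) * z ^ n)"
      by (rule summable_finite[of "{0}"]) (auto simp: True)
    then show ?thesis unfolding h_def by (rule summable_sums)
  next
    case False
    have "summable (\<lambda>n. b (Suc n) * z ^ Suc n)"
      using f[OF that] sums_summable by (subst summable_Suc_iff) blast
    hence "summable (\<lambda>n. b (Suc n) * z ^ Suc n * inverse z)" by (rule summable_mult2)
    also have "(\<lambda>n. b (Suc n) * z ^ Suc n * inverse z) = (\<lambda>n. b (Suc n) * z ^ n)"
      using False by (simp add: fun_eq_iff)
    finally show ?thesis unfolding h_def by (rule summable_sums)
  qed
  have holh: "h holomorphic_on ball 0 1"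
    by (rule power_series_holomorphic[where a = "\<lambda>n. b (Suc n)"]) (use h in simp)
  have holf: "f holomorphic_on ball 0 1"
    by (rule power_series_holomorphic[where a = b]) (use f in simp)
  have fh: "f z = b 0 + z * h z" if "z \<in> ball 0 1" for z
  proof -
    have "(\<lambda>n. z * (b (Suc n) * z ^ n)) sums (z * h z)" by (rule sums_mult[OF h[OF that]])
    hence "(\<lambda>n. b (Suc n) * z ^ Suc n) sums (z * h z)" by (simp add: mult_ac)
    hence "(\<lambda>n. b n * z ^ n) sums (z * h z + b 0 * z ^ 0)" by (subst (asm) sums_Suc_iff) simp
    with f[OF that] show ?thesis using sums_unique2 by (fastforce simp: add.commute)
  qed
  let ?c = "circlepath 0 r"
  have c: "cmod (?c t) = r" for t using r by (rule_tac norm_circlepath0)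
  have eq: "(cmod (f (?c t)))\<^sup>2 = (cmod (b 0))\<^sup>2 + 2 * Re (cnj (b 0) * (?c t * h (?c t))) +
      r\<^sup>2 * (cmod (h (?c t)))\<^sup>2" for t
  proof -
    have *: "(cmod (x + y))\<^sup>2 = (cmod x)\<^sup>2 + 2 * Re (cnj x * y) + (cmod y)\<^sup>2" for x y
      unfolding cmod_power2 by (simp add: power2_eq_square algebra_simps)
    show ?thesis
      using fh[of "?c t"] c[of t] r by (simp add: * norm_mult power_mult_distrib)
  qed
  have i1: "((\<lambda>t. (cmod (b 0))\<^sup>2) has_integral (cmod (b 0))\<^sup>2) {0..1::real}"
    using has_integral_const_real[of "(cmod (b 0))\<^sup>2" 0 1] by simp
  have i2: "((\<lambda>t. 2 * Re (cnj (b 0) * (?c t * h (?c t)))) has_integral 0) {0..1}"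
    using has_integral_mult_right[OF has_integral_Re[OF has_integral_mult_right[OF
      circle_integral_holomorphic[OF holh r], of "cnj (b 0)"]], of 2] by simp
  have i3: "((\<lambda>t. (cmod (h (?c t)))\<^sup>2) has_integral
      integral {0..1} (\<lambda>t. (cmod (h (?c t)))\<^sup>2)) {0..1}"
    by (intro integrable_integral integrable_continuous_interval continuous_intros
          circle_continuous holh r)
  have "integral {0..1} (\<lambda>t. (cmod (f (?c t)))\<^sup>2) =
      (cmod (b 0))\<^sup>2 + r\<^sup>2 * integral {0..1} (\<lambda>t. (cmod (h (?c t)))\<^sup>2)"
    unfolding eq
    using has_integral_add[OF has_integral_add[OF i1 i2] has_integral_mult_right[OF i3, of "r\<^sup>2"]]
    by (intro integral_unique) simp
  moreover have "r\<^sup>2 * (\<Sum>n<N. (cmod (b (Suc n)))\<^sup>2 * (r\<^sup>2) ^ n)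
      \<le> r\<^sup>2 * integral {0..1} (\<lambda>t. (cmod (h (?c t)))\<^sup>2)"
    by (intro mult_left_mono Suc.IH h) auto
  ultimately show ?case
    by (subst sum.lessThan_Suc_shift) (simp add: sum_distrib_left mult_ac)
qed

text \<open>For fixed N, Bessel's inequality bounds a polynomial in r by M, and r tends to 1 from
  the left. The extra factor r in the assumption is the one that arc length contributes in
  \<open>hs_mean_eq\<close>.\<close>

lemma taylor_coeffs_square_summable:
  assumes f: "f holomorphic_on ball 0 1"
    and M: "\<And>r. 0 < r \<Longrightarrow> r < 1 \<Longrightarrow>
      r * integral {0..1} (\<lambda>t. (cmod (f (circlepath 0 r t)))\<^sup>2) \<le> M"
  shows "(\<Sum>n<N. (cmod (taylor_coeff f n))\<^sup>2) \<le> M"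
proof -
  let ?F = "\<lambda>r::real. r * (\<Sum>n<N. (cmod (taylor_coeff f n))\<^sup>2 * (r\<^sup>2) ^ n)"
  have le: "?F r \<le> M" if "0 < r" "r < 1" for r
  proof -
    have "?F r \<le> r * integral {0..1} (\<lambda>t. (cmod (f (circlepath 0 r t)))\<^sup>2)"
      using holomorphic_power_series[OF f] that
      by (intro mult_left_mono bessel_inequality_circle) (auto simp: taylor_coeff_def)
    with M[OF that] show ?thesis by simp
  qed
  have "(?F \<longlongrightarrow> ?F 1) (at_left 1)"
    by (intro tendsto_intros)
  moreover have "\<forall>\<^sub>F r in at_left 1. ?F r \<le> M"
    using eventually_at_left_real[of 0 1] le by (auto elim!: eventually_mono)
  ultimately have "?F 1 \<le> M"
    by (intro tendsto_upperbound) auto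
  thus ?thesis by simp
qed

section \<open>Invariant functions of a self-map of the disc\<close>

text \<open>If g is not a rotation, Schwarz gives |g z| < |z| off 0. A maximum point x of |G| on a
  closed disc about 0 is thus moved to an interior point g x, where G has the same value, and the
  maximum principle applies there.\<close>

lemma fixed_function_constant_on_disc:
  assumes g: "g holomorphic_on ball 0 1" "g 0 = 0" "\<And>z. cmod z < 1 \<Longrightarrow> cmod (g z) < 1"
    and nonrot: "\<nexists>\<alpha>. (\<forall>z. cmod z < 1 \<longrightarrow> g z = \<alpha> * z) \<and> cmod \<alpha> = 1"
    and G: "G holomorphic_on ball 0 1" "\<And>z. cmod z < 1 \<Longrightarrow> G (g z) = G z"
  shows "G constant_on ball 0 1"
proof -
  have lt: "cmod (g z) < cmod z" if "cmod z < 1" "z \<noteq> 0" for z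
    using Schwarz_Lemma[OF g that(1)] that nonrot by (meson less_le)
  let ?K = "cball 0 (1/2) :: complex set"
  have "continuous_on ?K (\<lambda>z. cmod (G z))"
    by (intro continuous_on_norm holomorphic_on_imp_continuous_on holomorphic_on_subset[OF G(1)]) auto
  then obtain x where x: "x \<in> ?K" "\<And>z. z \<in> ?K \<Longrightarrow> cmod (G z) \<le> cmod (G x)"
    using continuous_attains_sup[of ?K "\<lambda>z. cmod (G z)"] by auto
  \<comment> \<open>If the maximum sits at 0, it is already interior and g fixes it.\<close>
  have "g x \<in> ball 0 (1/2)"
    using x(1) lt[of x] g(2) by (cases "x = 0") auto
  moreover have "cmod (G z) \<le> cmod (G (g x))" if "z \<in> ball 0 (1/2)" for z
    using x G(2)[of x] that by auto
  ultimately show ?thesis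
    by (intro maximum_modulus_principle[OF G(1), where U = "ball 0 (1/2)" and \<xi> = "g x"]) auto
qed

section \<open>The Hardy-Smirnov space seen from the disc\<close>

text \<open>By the chain rule |dw| = 2 pi r |s|^2 dt along the image of the circle. The factor 2 pi
  cancels the normalization, while r stays.\<close>

lemma hs_mean_eq:
  assumes \<tau>: "\<tau> holomorphic_on ball 0 1" and sq: "\<And>z. z \<in> ball 0 1 \<Longrightarrow> (s z)\<^sup>2 = deriv \<tau> z"
    and r: "0 < r" "r < 1"
  shows "hs_mean \<tau> f r = r * integral {0..1} (\<lambda>t. (cmod (hs_V \<tau> s f (circlepath 0 r t)))\<^sup>2)"
proof -
  let ?c = "circlepath 0 r"
  have c: "?c t \<in> ball 0 1" for t using r by (simp add: norm_circlepath0)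
  have "vector_derivative (\<tau> \<circ> ?c) (at t) = vector_derivative ?c (at t) * deriv \<tau> (?c t)" for t
    using c[of t] holomorphic_on_imp_differentiable_at[OF \<tau> _ c]
    by (intro vector_derivative_chain_at_general)
       (auto intro: has_vector_derivative_circlepath differentiableI_vector)
  hence "norm (vector_derivative (\<tau> \<circ> ?c) (at t)) = 2 * pi * r * (cmod (s (?c t)))\<^sup>2" for t
    using r sq[OF c, of t, symmetric]
    by (simp add: vector_derivative_circlepath norm_mult norm_power)
  hence "arclength_integral (\<tau> \<circ> ?c) (\<lambda>w. (cmod (f w))\<^sup>2)
      = integral {0..1} (\<lambda>t. (2 * pi * r) * (cmod (hs_V \<tau> s f (?c t)))\<^sup>2)"
    unfolding arclength_integral_def
    by (intro integral_cong) (simp add: hs_V_def norm_mult power_mult_distrib)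
  thus ?thesis
    by (simp add: hs_mean_def)
qed

text \<open>\<open>V k\<close> is the Szego kernel at \<open>p\<close> divided by \<open>cnj (s p)\<close>, so \<open>k\<close> is the reproducing kernel
  of the Hardy-Smirnov space at \<open>\<tau> p\<close>.\<close>

definition hs_kernel ::
  "complex set \<Rightarrow> (complex \<Rightarrow> complex) \<Rightarrow> (complex \<Rightarrow> complex) \<Rightarrow> complex \<Rightarrow> complex \<Rightarrow> complex" where
  "hs_kernel \<Omega> \<tau> s p = (\<lambda>w. if w \<in> \<Omega>
     then let z = inv_into (ball 0 1) \<tau> w in 1 / (cnj (s p) * s z * (1 - cnj p * z)) else 0)"

lemma cnj_mult_neq_1:
  assumes "cmod p < 1" "cmod z < 1"
  shows "cnj p * z \<noteq> 1"
proof
  assume "cnj p * z = 1"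
  hence "cmod p * cmod z = 1" by (metis complex_mod_cnj norm_mult norm_one)
  moreover have "cmod p * cmod z \<le> cmod p * 1" using assms by (intro mult_left_mono) auto
  ultimately show False using assms by simp
qed

lemma taylor_coeff_szego_kernel:
  assumes "cmod p < 1"
  shows "taylor_coeff (\<lambda>z. a / (1 - cnj p * z)) n = a * cnj p ^ n"
proof -
  have "(\<lambda>n. a * cnj p ^ n * z ^ n) sums (a / (1 - cnj p * z))" if "z \<in> ball 0 1" for z
  proof -
    have "cmod (cnj p * z) \<le> cmod p * 1"
      unfolding norm_mult complex_mod_cnj using that by (intro mult_left_mono) auto
    hence "(\<lambda>n. a * (cnj p * z) ^ n) sums (a * (1 / (1 - cnj p * z)))"
      using assms by (intro sums_mult geometric_sums) simp
    thus ?thesis by (simp add: power_mult_distrib mult.assoc)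
  qed
  hence "(\<lambda>z. a / (1 - cnj p * z)) has_fps_expansion Abs_fps (\<lambda>n. a * cnj p ^ n)"
    by (intro has_fps_expansionI eventually_nhds_in_open[THEN eventually_mono, of "ball 0 1"]) auto
  from fps_nth_fps_expansion[OF this, of n] show ?thesis
    by (simp add: taylor_coeff_def)
qed

locale riemann_map_sqrt =
  fixes \<Omega> :: "complex set" and \<tau> s :: "complex \<Rightarrow> complex"
  assumes biholo: "biholomorphic_map \<tau> (ball 0 1) \<Omega>"
    and s_holo: "s holomorphic_on ball 0 1" and s_sq: "\<And>z. z \<in> ball 0 1 \<Longrightarrow> (s z)\<^sup>2 = deriv \<tau> z"
begin

abbreviation "\<sigma> \<equiv> inv_into (ball 0 1) \<tau>"
abbreviation "H \<equiv> hardy_smirnov \<Omega> \<tau>"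
abbreviation "k \<equiv> hs_kernel \<Omega> \<tau> s"

lemma \<tau>_holo: "\<tau> holomorphic_on ball 0 1" and \<sigma>_holo: "\<sigma> holomorphic_on \<Omega>"
  and \<tau>_inj: "inj_on \<tau> (ball 0 1)" and \<tau>_image: "\<tau> ` ball 0 1 = \<Omega>"
  using biholo by (auto simp: biholomorphic_map_def bij_betw_def)

lemma \<tau>_mem [simp]: "cmod z < 1 \<Longrightarrow> \<tau> z \<in> \<Omega>"
  using \<tau>_image by auto

lemma \<sigma>_\<tau> [simp]: "cmod z < 1 \<Longrightarrow> \<sigma> (\<tau> z) = z"
  using \<tau>_inj by simp

lemma \<tau>_\<sigma> [simp]: "w \<in> \<Omega> \<Longrightarrow> \<tau> (\<sigma> w) = w"
  using \<tau>_image by (simp add: f_inv_into_f)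

lemma \<sigma>_mem [simp]: "w \<in> \<Omega> \<Longrightarrow> cmod (\<sigma> w) < 1"
  using \<tau>_image inv_into_into[of w \<tau> "ball 0 1"] by simp

text \<open>An injective holomorphic map has no critical points; this justifies the divisions by
  \<open>s\<close> in \<open>hs_kernel\<close>.\<close>

lemma s_nonzero: "cmod z < 1 \<Longrightarrow> s z \<noteq> 0"
  using holomorphic_injective_imp_regular[OF \<tau>_holo _ \<tau>_inj] s_sq[of z]
  by (metis mem_ball_0 open_ball zero_power2)

lemma hs_V_kernel:
  "cmod z < 1 \<Longrightarrow> hs_V \<tau> s (k p) z = (1 / cnj (s p)) / (1 - cnj p * z)"
  using s_nonzero[of z] by (simp add: hs_V_def hs_kernel_def Let_def)

lemma hs_V_holo: "f holomorphic_on \<Omega> \<Longrightarrow> hs_V \<tau> s f holomorphic_on ball 0 1"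
  unfolding hs_V_def
  using holomorphic_on_compose_gen[OF \<tau>_holo, of f \<Omega>] \<tau>_image s_holo
  by (auto intro!: holomorphic_on_mult simp: o_def)

lemma kernel_holo:
  assumes "cmod p < 1"
  shows "k p holomorphic_on \<Omega>"
proof -
  have "(s \<circ> \<sigma>) holomorphic_on \<Omega>"
    by (rule holomorphic_on_compose_gen[OF \<sigma>_holo s_holo]) auto
  hence "(\<lambda>w. 1 / (cnj (s p) * s (\<sigma> w) * (1 - cnj p * \<sigma> w))) holomorphic_on \<Omega>"
    using assms by (intro holomorphic_intros \<sigma>_holo)
      (auto simp: o_def s_nonzero cnj_mult_neq_1)
  thus ?thesis
    by (rule holomorphic_transform) (simp add: hs_kernel_def Let_def)
qed

text \<open>The function V k is bounded on the disc, because |1 - cnj p * z| >= 1 - |p|, so its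
  circle means are bounded by the square \<open>?B\<close> of that bound.\<close>

lemma kernel_mem:
  assumes p: "cmod p < 1"
  shows "k p \<in> H"
proof -
  let ?B = "(1 / cmod (s p) / (1 - cmod p))\<^sup>2"
  have "hs_mean \<tau> (k p) r \<le> ?B" if r: "0 < r" "r < 1" for r
  proof -
    let ?I = "\<lambda>t. (cmod (hs_V \<tau> s (k p) (circlepath 0 r t)))\<^sup>2"
    have "?I t \<le> ?B" for t
    proof -
      let ?z = "circlepath 0 r t"
      have z: "cmod ?z = r" using r by (simp add: norm_circlepath0)
      have "1 - cmod p \<le> cmod 1 - cmod (cnj p * ?z)"
        using p r by (simp add: norm_mult z mult_left_le)
      also have "\<dots> \<le> cmod (1 - cnj p * ?z)" by (rule norm_triangle_ineq2)
      finally show ?thesis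
        using p r z cnj_mult_neq_1[OF p, of ?z]
        by (auto simp: hs_V_kernel norm_divide norm_mult s_nonzero intro!: power_mono frac_le mult_left_mono)
    qed
    hence "integral {0..1} ?I \<le> integral {0..1::real} (\<lambda>t. ?B)"
      using r p by (intro integral_le integrable_continuous_interval continuous_intros
        circle_continuous hs_V_holo kernel_holo) auto
    hence "integral {0..1} ?I \<le> ?B" by simp
    moreover have "0 \<le> integral {0..1} ?I"
      using r p by (intro integral_nonneg integrable_continuous_interval continuous_intros
        circle_continuous hs_V_holo kernel_holo) auto
    ultimately have "r * integral {0..1} ?I \<le> 1 * ?B"
      using r by (intro mult_mono) auto
    thus ?thesis using hs_mean_eq[OF \<tau>_holo s_sq r] by simp
  qed
  hence "bdd_above (hs_mean \<tau> (k p) ` {0<..<1})" by (intro bdd_aboveI[where M = ?B]) auto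
  thus ?thesis
    using kernel_holo[OF p] by (auto simp: hardy_smirnov_def hs_kernel_def)
qed

lemma taylor_coeff_kernel:
  assumes "cmod p < 1"
  shows "taylor_coeff (hs_V \<tau> s (k p)) n = (1 / cnj (s p)) * cnj p ^ n"
proof -
  have "(deriv ^^ n) (hs_V \<tau> s (k p)) 0 = (deriv ^^ n) (\<lambda>z. (1 / cnj (s p)) / (1 - cnj p * z)) 0"
    by (rule higher_deriv_transform_within_open[where S = "ball 0 1"])
       (use assms in \<open>auto intro!: holomorphic_intros hs_V_holo kernel_holo
          simp: hs_V_kernel cnj_mult_neq_1\<close>)
  thus ?thesis
    using taylor_coeff_szego_kernel[OF assms, of "1 / cnj (s p)" n] by (simp add: taylor_coeff_def)
qed

text \<open>Pairing with the coefficients of V k sums the Taylor series of V f at p and divides by s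
  p, which undoes the factor in V f p = f (\<tau> p) * s p. Convergence of that Taylor series gives
  the formula for every holomorphic f.\<close>

lemma kernel_reproduces:
  assumes f: "f holomorphic_on \<Omega>" and p: "cmod p < 1"
  shows "hs_inner \<tau> s f (k p) = f (\<tau> p)" and "hs_inner \<tau> s (k p) f = cnj (f (\<tau> p))"
proof -
  let ?F = "hs_V \<tau> s f"
  have "(\<lambda>n. taylor_coeff ?F n * p ^ n) sums ?F p"
    using holomorphic_power_series[OF hs_V_holo[OF f], of p] p by (simp add: taylor_coeff_def)
  hence "(\<lambda>n. taylor_coeff ?F n * p ^ n * (1 / s p)) sums (?F p * (1 / s p))"
    by (rule sums_mult2)
  hence *: "(\<lambda>n. taylor_coeff ?F n * cnj (taylor_coeff (hs_V \<tau> s (k p)) n)) sums f (\<tau> p)"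
    using s_nonzero[OF p] by (simp add: taylor_coeff_kernel[OF p]) (simp add: hs_V_def)
  thus "hs_inner \<tau> s f (k p) = f (\<tau> p)"
    by (simp add: hs_inner_def hardy_inner_def sums_iff)
  from * have "(\<lambda>n. cnj (taylor_coeff ?F n * cnj (taylor_coeff (hs_V \<tau> s (k p)) n)))
      sums cnj (f (\<tau> p))" by (subst sums_cnj)
  thus "hs_inner \<tau> s (k p) f = cnj (f (\<tau> p))"
    by (simp add: hs_inner_def hardy_inner_def sums_iff mult.commute)
qed

section \<open>The fixed kernel and the fixed functions\<close>

text \<open>Pairing with the kernel at q reads off values at \<tau> q, so it suffices to test
  against kernels: <k q, S (k p)> = <T (k q), k p> = k q (\<Phi> (\<tau> p)) = k q (\<tau> p) = <k
  q, k p>, where T is the composition operator.\<close>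

lemma adjoint_fixes_kernel:
  assumes \<Phi>: "\<Phi> holomorphic_on \<Omega>" "\<Phi> ` \<Omega> \<subseteq> \<Omega>"
    and p: "cmod p < 1" "\<Phi> (\<tau> p) = \<tau> p"
    and S: "is_adjoint_on H (hs_inner \<tau> s) (composition_op \<Omega> \<Phi>) S"
  shows "S (k p) = k p"
proof
  fix w
  have SH: "S (k p) \<in> H" and adj: "\<And>f. f \<in> H \<Longrightarrow>
      hs_inner \<tau> s (composition_op \<Omega> \<Phi> f) (k p) = hs_inner \<tau> s f (S (k p))"
    using S kernel_mem[OF p(1)] by (auto simp: is_adjoint_on_def)
  show "S (k p) w = k p w"
  proof (cases "w \<in> \<Omega>")
    \<comment> \<open>Outside \<Omega> both sides vanish, by the convention of extension by
      0.\<close>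
    case False
    thus ?thesis using SH by (simp add: hardy_smirnov_def hs_kernel_def)
  next
    case True
    define q where "q = \<sigma> w"
    have q: "cmod q < 1" "\<tau> q = w" using True by (auto simp: q_def)
    have "(k q \<circ> \<Phi>) holomorphic_on \<Omega>"
      by (rule holomorphic_on_compose_gen[OF \<Phi>(1) kernel_holo[OF q(1)] \<Phi>(2)])
    hence "composition_op \<Omega> \<Phi> (k q) holomorphic_on \<Omega>"
      by (rule holomorphic_transform) (simp add: composition_op_def)
    hence "hs_inner \<tau> s (k q) (S (k p)) = k q (\<tau> p)"
      using adj[OF kernel_mem[OF q(1)]] p
      by (simp add: kernel_reproduces composition_op_def)
    also have "\<dots> = hs_inner \<tau> s (k q) (k p)"
      using kernel_reproduces(1)[OF kernel_holo[OF q(1)] p(1)] by simp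
    finally show ?thesis
      using SH kernel_reproduces(2)[OF kernel_holo[OF p(1)] q(1)]
        kernel_reproduces(2)[of "S (k p)", OF _ q(1)] q(2)
      by (simp add: hardy_smirnov_def)
  qed
qed

text \<open>A disc automorphism taking p to 0 turns \<Phi> into a self-map g of the disc fixing 0. A
  rotation g would make \<Phi> an automorphism of \<Omega>, so the disc version applies.\<close>

lemma fixed_function_constant:
  assumes \<Phi>: "\<Phi> holomorphic_on \<Omega>" "\<Phi> ` \<Omega> \<subseteq> \<Omega>" "\<not> biholomorphic_map \<Phi> \<Omega> \<Omega>"
    and p: "cmod p < 1" "\<Phi> (\<tau> p) = \<tau> p"
    and f: "f holomorphic_on \<Omega>" "\<And>w. w \<in> \<Omega> \<Longrightarrow> f (\<Phi> w) = f w"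
  shows "f constant_on \<Omega>"
proof -
  obtain m n where m: "m p = 0" "m holomorphic_on ball 0 1" "m ` ball 0 1 \<subseteq> ball 0 1"
    and n: "n holomorphic_on ball 0 1" "n ` ball 0 1 \<subseteq> ball 0 1"
    and mn: "\<And>z. z \<in> ball 0 1 \<Longrightarrow> m (n z) = z" "\<And>z. z \<in> ball 0 1 \<Longrightarrow> n (m z) = z"
    using ball_biholomorphism_exists[of p] p(1) by (auto simp: image_subset_iff)
  \<comment> \<open>\<open>u\<close> and \<open>v\<close> are mutually inverse biholomorphic maps
    between the disc and \<Omega>, with u 0 = \<tau> p.\<close>
  define u where "u = \<tau> \<circ> n"
  define v where "v = m \<circ> \<sigma>"
  have u: "u holomorphic_on ball 0 1" "u ` ball 0 1 \<subseteq> \<Omega>"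
    unfolding u_def using n by (auto intro!: holomorphic_on_compose_gen[OF _ \<tau>_holo] simp: image_subset_iff)
  have v: "v holomorphic_on \<Omega>" "v ` \<Omega> \<subseteq> ball 0 1"
    unfolding v_def using m by (auto intro!: holomorphic_on_compose_gen[OF \<sigma>_holo] simp: image_subset_iff)
  have uv: "u (v w) = w" if "w \<in> \<Omega>" for w
    using that mn by (simp add: u_def v_def)
  have vu: "v (u z) = z" if "z \<in> ball 0 1" for z
    using that mn n(2) by (simp add: u_def v_def image_subset_iff)
  have u0: "u 0 = \<tau> p" using mn(2)[of p] m(1) p(1) by (simp add: u_def)
  define g where "g = v \<circ> (\<Phi> \<circ> u)"
  have g: "g holomorphic_on ball 0 1"
    unfolding g_def using u v \<Phi>
    by (auto intro!: holomorphic_on_compose_gen[where t = \<Omega>] simp: image_subset_iff)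
  have g0: "g 0 = 0" using vu[of 0] by (simp add: g_def u0 p)
  have g_ball: "cmod (g z) < 1" if "cmod z < 1" for z
    using that u(2) v(2) \<Phi>(2) by (auto simp: g_def image_subset_iff)
  have nonrot: "\<nexists>\<alpha>. (\<forall>z. cmod z < 1 \<longrightarrow> g z = \<alpha> * z) \<and> cmod \<alpha> = 1"
  proof
    assume "\<exists>\<alpha>. (\<forall>z. cmod z < 1 \<longrightarrow> g z = \<alpha> * z) \<and> cmod \<alpha> = 1"
    then obtain \<alpha> where \<alpha>: "\<And>z. cmod z < 1 \<Longrightarrow> g z = \<alpha> * z" "cmod \<alpha> = 1" by blast
    have a0: "\<alpha> \<noteq> 0" using \<alpha>(2) by auto
    have v_lt: "cmod (v w) < 1" if "w \<in> \<Omega>" for w using v(2) that by auto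
    have u_mem: "u z \<in> \<Omega>" if "cmod z < 1" for z using u(2) that by auto
    have \<Phi>_eq: "\<Phi> w = u (\<alpha> * v w)" if "w \<in> \<Omega>" for w
    proof -
      have "v (\<Phi> w) = \<alpha> * v w"
        using \<alpha>(1)[OF v_lt[OF that]] by (simp add: g_def uv that)
      thus ?thesis using uv[of "\<Phi> w"] that \<Phi>(2) by auto
    qed
    \<comment> \<open>The inverse of \<Phi> = u o (rotation by \<alpha>) o v, obtained by rotating
      back.\<close>
    define \<Psi> where "\<Psi> w = u (v w / \<alpha>)" for w
    have \<Psi>_mem: "\<Psi> w \<in> \<Omega>" if "w \<in> \<Omega>" for w
      unfolding \<Psi>_def using that v_lt \<alpha>(2) by (intro u_mem) (simp add: norm_divide)
    have inv1: "\<Psi> (\<Phi> w) = w" if "w \<in> \<Omega>" for w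
      using that a0 v_lt[OF that] \<alpha>(2) by (simp add: \<Phi>_eq \<Psi>_def vu norm_mult uv)
    have inv2: "\<Phi> (\<Psi> w) = w" if "w \<in> \<Omega>" for w
      using that a0 v_lt[OF that] \<alpha>(2) \<Psi>_mem[OF that]
      by (simp add: \<Phi>_eq) (simp add: \<Psi>_def vu norm_divide uv)
    have bij: "bij_betw \<Phi> \<Omega> \<Omega>"
      by (rule bij_betw_byWitness[where f' = \<Psi>]) (use inv1 inv2 \<Phi>(2) \<Psi>_mem in auto)
    have "inv_into \<Omega> \<Phi> w = \<Psi> w" if "w \<in> \<Omega>" for w
      using inv_into_f_eq[OF bij_betw_imp_inj_on[OF bij] \<Psi>_mem[OF that] inv2[OF that]] .
    moreover have "(u \<circ> (\<lambda>w. v w / \<alpha>)) holomorphic_on \<Omega>"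
      by (rule holomorphic_on_compose_gen[OF _ u(1)])
         (use v_lt \<alpha>(2) v(1) a0 in \<open>auto intro!: holomorphic_intros simp: norm_divide\<close>)
    ultimately have "inv_into \<Omega> \<Phi> holomorphic_on \<Omega>"
      by (auto intro: holomorphic_transform simp: \<Psi>_def)
    with bij \<Phi> show False by (simp add: biholomorphic_map_def)
  qed
  have "(f \<circ> u) constant_on ball 0 1"
  proof (rule fixed_function_constant_on_disc[OF g g0 g_ball nonrot])
    show "(f \<circ> u) holomorphic_on ball 0 1"
      by (rule holomorphic_on_compose_gen[OF u(1) f(1) u(2)])
    show "(f \<circ> u) (g z) = (f \<circ> u) z" if "cmod z < 1" for z
      using that u(2) \<Phi>(2) f(2) by (auto simp: g_def uv image_subset_iff)
  qed
  then obtain c where c: "\<And>z. z \<in> ball 0 1 \<Longrightarrow> f (u z) = c" by (auto simp: constant_on_def)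
  have "f w = c" if "w \<in> \<Omega>" for w
    using c[of "v w"] uv[OF that] v(2) that by auto
  thus ?thesis by (auto simp: constant_on_def)
qed

text \<open>For a constant c on \<Omega>, V f = c * s, so dividing the bound on the means by |c|^2
  puts \<open>s\<close> itself in the classical Hardy space.\<close>

lemma bounded_if_constant_mem:
  assumes f: "f \<in> H" and c: "\<And>w. w \<in> \<Omega> \<Longrightarrow> f w = c" "c \<noteq> 0"
  shows "bounded \<Omega>"
proof -
  from f obtain M where M: "\<And>r. 0 < r \<Longrightarrow> r < 1 \<Longrightarrow> hs_mean \<tau> f r \<le> M"
    unfolding hardy_smirnov_def bdd_above_def by fastforce
  have "(\<Sum>n<N. (cmod (taylor_coeff s n))\<^sup>2) \<le> M / (cmod c)\<^sup>2" for N
  proof (rule taylor_coeffs_square_summable[OF s_holo])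
    fix r :: real assume r: "0 < r" "r < 1"
    have "integral {0..1} (\<lambda>t. (cmod (hs_V \<tau> s f (circlepath 0 r t)))\<^sup>2)
        = integral {0..1} (\<lambda>t. (cmod c)\<^sup>2 * (cmod (s (circlepath 0 r t)))\<^sup>2)"
      using r c(1) by (intro integral_cong)
        (simp add: hs_V_def norm_circlepath0 norm_mult power_mult_distrib)
    moreover have "hs_mean \<tau> f r = r * integral {0..1} (\<lambda>t. (cmod (hs_V \<tau> s f (circlepath 0 r t)))\<^sup>2)"
      by (rule hs_mean_eq[OF \<tau>_holo s_sq r])
    ultimately have "r * ((cmod c)\<^sup>2 * integral {0..1} (\<lambda>t. (cmod (s (circlepath 0 r t)))\<^sup>2)) \<le> M"
      using M[OF r] by simp
    thus "r * integral {0..1} (\<lambda>t. (cmod (s (circlepath 0 r t)))\<^sup>2) \<le> M / (cmod c)\<^sup>2"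
      using c(2) by (simp add: field_simps)
  qed
  from bounded_if_deriv_square_coeffs[OF s_holo \<tau>_holo s_sq this] show ?thesis
    by (simp add: \<tau>_image)
qed

end

section \<open>Failure of complex symmetry on unbounded domains\<close>

theorem theorem5p6:
  fixes \<Omega> :: "complex set" and \<tau> s \<Phi> :: "complex \<Rightarrow> complex"
  assumes "open \<Omega>" and "simply_connected \<Omega>" and "\<Omega> \<noteq> UNIV"
    and "biholomorphic_map \<tau> (ball 0 1) \<Omega>"
    and "s holomorphic_on ball 0 1" and "\<And>z. z \<in> ball 0 1 \<Longrightarrow> (s z)\<^sup>2 = deriv \<tau> z"
    and "\<not> bounded \<Omega>"
    and "\<Phi> holomorphic_on \<Omega>" and "\<Phi> ` \<Omega> \<subseteq> \<Omega>"
    and "\<not> biholomorphic_map \<Phi> \<Omega> \<Omega>"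
    and "\<exists>w\<in>\<Omega>. \<Phi> w = w"
    and "bounded_operator_on (hardy_smirnov \<Omega> \<tau>) (hs_norm \<tau>) (composition_op \<Omega> \<Phi>)"
  shows "\<not> complex_symmetric_on (hardy_smirnov \<Omega> \<tau>) (hs_inner \<tau> s) (composition_op \<Omega> \<Phi>)"
proof
  interpret riemann_map_sqrt \<Omega> \<tau> s
    using assms by unfold_locales auto
  let ?T = "composition_op \<Omega> \<Phi>"
  assume "complex_symmetric_on H (hs_inner \<tau> s) ?T"
  then obtain C S where C: "conjugation_on H (hs_inner \<tau> s) C"
    and S: "is_adjoint_on H (hs_inner \<tau> s) ?T S" and CT: "\<And>f. f \<in> H \<Longrightarrow> C (?T f) = S (C f)"
    by (auto simp: complex_symmetric_on_def)
  have C_mem: "C f \<in> H" and CC: "C (C f) = f" if "f \<in> H" for f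
    using C that by (auto simp: conjugation_on_def)
  obtain w where w: "w \<in> \<Omega>" "\<Phi> w = w" using assms by blast
  define p where "p = \<sigma> w"
  have p: "cmod p < 1" "\<tau> p = w" "\<Phi> (\<tau> p) = \<tau> p" using w by (auto simp: p_def)
  define f where "f = C (k p)"
  have kH: "k p \<in> H" by (rule kernel_mem[OF p(1)])
  have fH: "f \<in> H" using C_mem[OF kH] by (simp add: f_def)
  \<comment> \<open>Membership makes C (C (T f)) = T f available below.\<close>
  have TfH: "?T f \<in> H" using assms(12) fH by (simp add: bounded_operator_on_def)
  \<comment> \<open>C (T f) = S (C f) = S (k p) = k p; applying \<open>C\<close> once more gives T f
    = f.\<close>
  have "C (?T f) = k p"
    using CT[OF fH] CC[OF kH] adjoint_fixes_kernel[OF assms(8,9) p(1,3) S] by (simp add: f_def)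
  hence "?T f = f" using CC[OF TfH] by (simp add: f_def)
  hence "f (\<Phi> z) = f z" if "z \<in> \<Omega>" for z
    using that by (metis composition_op_def)
  moreover have "f holomorphic_on \<Omega>" using fH by (simp add: hardy_smirnov_def)
  ultimately have "f constant_on \<Omega>"
    using fixed_function_constant[OF assms(8,9,10) p(1,3)] by blast
  then obtain c where c: "\<And>z. z \<in> \<Omega> \<Longrightarrow> f z = c" by (auto simp: constant_on_def)
  have "c = 0"
    using bounded_if_constant_mem[OF fH c] assms(7) by blast
  hence f0: "f = (\<lambda>z. 0)"
    using c fH by (auto simp: hardy_smirnov_def)
  \<comment> \<open>Conjugate-linearity with zero coefficients gives C 0 = 0, hence k p = C f = 0.
    But k p takes the value 1 / (|s p|^2 * (1 - |p|^2)) at \<tau> p.\<close>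
  have "C (\<lambda>x. 0 * f x + 0 * f x) = (\<lambda>x. cnj 0 * C f x + cnj 0 * C f x)"
    using C fH unfolding conjugation_on_def by blast
  hence "k p = (\<lambda>z. 0)"
    using CC[OF kH] by (simp add: f0 flip: f_def)
  moreover have "k p (\<tau> p) \<noteq> 0"
    using p(1) s_nonzero cnj_mult_neq_1[of p p] by (simp add: hs_kernel_def)
  ultimately show False by simp
qed

end
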